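(* Let $N_\alpha$ and $N_\beta$ be independent homogeneous Poisson processes with rates $\lambda_\alpha>0$ and $\lambda_\beta>0$ respectively. For an integer $k\ge1$ let $T_k=\inf\{s: N_\alpha(N_\beta(s))=k\}$. Then $\Pr\{T_k<\infty\}<1$ for all $k\ge1$.
   Context: Poisson processes start at $0$ at time $0$ and have right-continuous paths. Convention: $\inf\emptyset=+\infty$. *)

theory Defs
  imports "HOL-Probability.Probability"
begin

(* Homogeneous Poisson process of rate r on [0, infinity).  Time is real; only the values at
   nonnegative times are constrained.  Increments are taken in int, because subtraction on nat
   truncates.  Monotonicity of the paths is not assumed: it holds almost surely, as a consequence
   of the increments being Poisson distributed and the paths right-continuous. *)
locale poisson_process = prob_space M for M :: "'a measure" +
  fixes r :: real and N :: "real \<Rightarrow> 'a \<Rightarrow> nat"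
  assumes rate_pos: "r > 0"
    and random_variable_N: "\<And>t. t \<ge> 0 \<Longrightarrow> random_variable (count_space UNIV) (N t)"
    and start: "\<And>\<omega>. \<omega> \<in> space M \<Longrightarrow> N 0 \<omega> = 0"
    and right_continuous:
      "\<And>\<omega> t. \<omega> \<in> space M \<Longrightarrow> t \<ge> 0 \<Longrightarrow> continuous (at_right t) (\<lambda>s. N s \<omega>)"
    and independent_increments:
      "\<And>(n :: nat) (t :: nat \<Rightarrow> real). t 0 \<ge> 0 \<Longrightarrow> (\<And>i. i < n \<Longrightarrow> t i < t (Suc i)) \<Longrightarrow>
         indep_vars (\<lambda>_. count_space UNIV)
           (\<lambda>i \<omega>. int (N (t (Suc i)) \<omega>) - int (N (t i) \<omega>)) {..<n}"
    and poisson_increments: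
      "\<And>s t. 0 \<le> s \<Longrightarrow> s < t \<Longrightarrow>
         distr M (count_space UNIV) (\<lambda>\<omega>. int (N t \<omega>) - int (N s \<omega>)) =
         measure_pmf (map_pmf int (poisson_pmf (r * (t - s))))"

(* Independence of two nat-valued processes indexed by [0, infinity), seen as random elements of
   the product space, i.e. independence of the sigma-algebras generated by the whole processes. *)
definition indep_processes ::
    "'a measure \<Rightarrow> (real \<Rightarrow> 'a \<Rightarrow> nat) \<Rightarrow> (real \<Rightarrow> 'a \<Rightarrow> nat) \<Rightarrow> bool" where
  "indep_processes M X Y \<longleftrightarrow>
     prob_space.indep_var M
       (PiM {0..} (\<lambda>_. count_space UNIV)) (\<lambda>\<omega>. \<lambda>t\<in>{0..}. X t \<omega>)
       (PiM {0..} (\<lambda>_. count_space UNIV)) (\<lambda>\<omega>. \<lambda>t\<in>{0..}. Y t \<omega>)"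

definition iterated_process ::
    "(real \<Rightarrow> 'a \<Rightarrow> nat) \<Rightarrow> (real \<Rightarrow> 'a \<Rightarrow> nat) \<Rightarrow> real \<Rightarrow> 'a \<Rightarrow> nat" where
  "iterated_process X Y s \<omega> = X (real (Y s \<omega>)) \<omega>"

(* The infimum is taken in ereal, so that it is infinity for the empty set. *)
definition hitting_time :: "(real \<Rightarrow> 'a \<Rightarrow> nat) \<Rightarrow> nat \<Rightarrow> 'a \<Rightarrow> ereal" where
  "hitting_time X k \<omega> = Inf {ereal s | s. s \<ge> 0 \<and> X s \<omega> = k}"

lemma hitting_time_less_top_iff:
  "hitting_time X k \<omega> < \<infinity> \<longleftrightarrow> (\<exists>s\<ge>0. X s \<omega> = k)"
  unfolding hitting_time_def Inf_less_iff by auto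

(* The event in question is measurable, so its measure is not the default value 0. *)
lemma hitting_time_finite_measurable:
  assumes "poisson_process M r N" "poisson_process M r' N'"
  shows "{\<omega> \<in> space M. hitting_time (iterated_process N N') k \<omega> < \<infinity>} \<in> sets M"
proof -
  interpret A: poisson_process M r N by fact
  interpret B: poisson_process M r' N' by fact
  have rat: "\<exists>q\<in>{q \<in> \<rat>. q \<ge> 0}. N' q \<omega> = N' s \<omega>" if "\<omega> \<in> space M" "s \<ge> 0" for \<omega> s
  proof -
    have "((\<lambda>u. N' u \<omega>) \<longlongrightarrow> N' s \<omega>) (at_right s)"
      using B.right_continuous[OF that] by (simp add: continuous_within)
    then have "\<forall>\<^sub>F u in at_right s. N' u \<omega> = N' s \<omega>"
      by (simp add: tendsto_discrete)
    then obtain b where b: "b > s" "\<And>u. s < u \<Longrightarrow> u < b \<Longrightarrow> N' u \<omega> = N' s \<omega>"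
      unfolding eventually_at_right_field by blast
    then obtain q where "q \<in> \<rat>" "s < q" "q < b"
      using Rats_dense_in_real by blast
    with b that show ?thesis by force
  qed
  have eq: "{\<omega> \<in> space M. hitting_time (iterated_process N N') k \<omega> < \<infinity>} =
    (\<Union>n. \<Union>q\<in>{q \<in> \<rat>. q \<ge> 0}.
       {\<omega> \<in> space M. N (real n) \<omega> = k} \<inter> {\<omega> \<in> space M. N' q \<omega> = n})"
    unfolding hitting_time_less_top_iff iterated_process_def using rat by fastforce
  have ev: "{\<omega> \<in> space M. X t \<omega> = m} \<in> sets M"
    if "X t \<in> measurable M (count_space UNIV)" for X :: "real \<Rightarrow> 'a \<Rightarrow> nat" and t m
    using measurable_sets[OF that, of "{m}"] by (simp add: vimage_def Int_def conj_commute)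
  have "countable {q :: real. q \<in> \<rat> \<and> q \<ge> 0}"
    by (rule countable_subset[OF _ countable_rat]) auto
  moreover have "{\<omega> \<in> space M. N (real n) \<omega> = k} \<inter> {\<omega> \<in> space M. N' q \<omega> = n} \<in> sets M"
    if "q \<ge> 0" for n q
    using that by (intro sets.Int ev A.random_variable_N B.random_variable_N) auto
  ultimately show ?thesis unfolding eq
    by (intro sets.countable_UN' countableI_type) blast+
qed

end

theory Submission
  imports Defs
begin

text \<open>With positive probability the outer process has already jumped past \<open>k\<close> at time 1. The inner
  process takes integer values, so the composition samples the outer process only at the times
  \<open>0, 1, 2, \<dots>\<close>, and by monotonicity it then skips the value \<open>k\<close>.\<close>

context poisson_process
begin

lemma increment_random_variable:
  assumes "0 \<le> s" "0 \<le> t"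
  shows "(\<lambda>\<omega>. int (N t \<omega>) - int (N s \<omega>)) \<in> measurable M (count_space UNIV)"
proof -
  note [measurable] = random_variable_N[OF assms(1)] random_variable_N[OF assms(2)]
  show ?thesis by measurable
qed

text \<open>Paths are not assumed monotone, but the increment has a Poisson law, which lives on the
  nonnegative integers. The exceptional null set depends on \<open>s\<close> and
  \<open>t\<close>.\<close>

lemma AE_le:
  assumes "0 \<le> s" "s \<le> t"
  shows "AE \<omega> in M. N s \<omega> \<le> N t \<omega>"
proof (cases "s = t")
  case False
  with assms have st: "s < t" by simp
  have "AE x in distr M (count_space UNIV) (\<lambda>\<omega>. int (N t \<omega>) - int (N s \<omega>)). 0 \<le> x"
    unfolding poisson_increments[OF assms(1) st] by (auto simp: AE_measure_pmf_iff)
  then have "AE \<omega> in M. 0 \<le> int (N t \<omega>) - int (N s \<omega>)"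
    using assms by (subst (asm) AE_distr_iff) (auto intro!: increment_random_variable)
  then show ?thesis by eventually_elim simp
qed simp

text \<open>As \<open>N 0\<close> vanishes on \<open>space M\<close>, \<open>N t\<close> is itself
  the increment over the interval from 0 to \<open>t\<close>.\<close>

lemma prob_eq:
  assumes "0 < t"
  shows "prob {\<omega> \<in> space M. N t \<omega> = n} = pmf (poisson_pmf (r * t)) n"
proof -
  have "pmf (poisson_pmf (r * t)) n = measure (map_pmf int (poisson_pmf (r * t))) {int n}"
    by (simp add: measure_pmf_single pmf_map_inj')
  also have "\<dots> = measure (distr M (count_space UNIV) (\<lambda>\<omega>. int (N t \<omega>) - int (N 0 \<omega>))) {int n}"
    using poisson_increments[of 0 t] assms by simp
  also have "\<dots> = prob ((\<lambda>\<omega>. int (N t \<omega>) - int (N 0 \<omega>)) -` {int n} \<inter> space M)"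
    using assms by (intro measure_distr increment_random_variable) auto
  also have "(\<lambda>\<omega>. int (N t \<omega>) - int (N 0 \<omega>)) -` {int n} \<inter> space M = {\<omega> \<in> space M. N t \<omega> = n}"
    using start by auto
  finally show ?thesis by simp
qed

text \<open>A Poisson law with positive parameter charges every natural number.\<close>

lemma not_AE_neq:
  assumes "0 < t"
  shows "\<not> (AE \<omega> in M. N t \<omega> \<noteq> n)"
proof
  assume "AE \<omega> in M. N t \<omega> \<noteq> n"
  then have "prob {\<omega> \<in> space M. N t \<omega> = n} = 0"
    by (subst prob_eq_0) (use assms random_variable_N[of t] in auto)
  then show False
    using rate_pos assms by (simp add: prob_eq)
qed

end

theorem mainTheorem4:
  fixes M :: "'a measure"
    and rate_\<alpha> rate_\<beta> :: real
    and N_\<alpha> N_\<beta> :: "real \<Rightarrow> 'a \<Rightarrow> nat"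
  assumes "prob_space M"
    and "rate_\<alpha> > 0" and "rate_\<beta> > 0"
    and "poisson_process M rate_\<alpha> N_\<alpha>"
    and "poisson_process M rate_\<beta> N_\<beta>"
    and "indep_processes M N_\<alpha> N_\<beta>"
  shows "\<forall>k\<ge>1. measure M {\<omega> \<in> space M. hitting_time (iterated_process N_\<alpha> N_\<beta>) k \<omega> < \<infinity>} < 1"
proof (intro allI impI)
  fix k :: nat
  assume k: "k \<ge> 1"
  interpret A: poisson_process M rate_\<alpha> N_\<alpha> by fact
  let ?S = "{\<omega> \<in> space M. hitting_time (iterated_process N_\<alpha> N_\<beta>) k \<omega> < \<infinity>}"
  have S: "?S \<in> sets M"
    using assms by (intro hitting_time_finite_measurable)
  have "A.prob ?S \<noteq> 1"
  proof
    assume "A.prob ?S = 1"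
    then have "AE \<omega> in M. \<omega> \<in> ?S"
      using S A.prob_eq_1 by blast
    \<comment> \<open>Only integer times matter, since the inner process takes values in
      \<open>nat\<close>; so countably many null sets are discarded.\<close>
    moreover have "AE \<omega> in M. \<forall>n\<ge>1. N_\<alpha> 1 \<omega> \<le> N_\<alpha> (real n) \<omega>"
      by (auto simp: AE_all_countable intro!: A.AE_le)
    \<comment> \<open>\<open>Suc k\<close> stands for a value already beyond \<open>k\<close> at
      time 1: from there, \<open>k\<close> can no longer be attained at any integer time from 1
      on.\<close>
    ultimately have "AE \<omega> in M. N_\<alpha> 1 \<omega> \<noteq> Suc k"
    proof eventually_elim
      case (elim \<omega>)
      then obtain n :: nat where n: "N_\<alpha> (real n) \<omega> = k"
        unfolding hitting_time_less_top_iff iterated_process_def by auto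
      \<comment> \<open>Time 0 is excluded because the outer process starts at 0, whereas
        \<open>k\<close> is at least 1.\<close>
      moreover have "n \<noteq> 0"
        using n k elim(1) A.start[of \<omega>] by (cases n) auto
      ultimately have "N_\<alpha> 1 \<omega> \<le> k"
        using elim(2) by force
      then show ?case by simp
    qed
    then show False
      using A.not_AE_neq[of 1 "Suc k"] by simp
  qed
  then show "A.prob ?S < 1"
    using A.prob_le_1[of ?S] by linarith
qed

end
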